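(* Let $1\le k\le n$, excluding the case where $n$ is odd and $k=1$. Then there are numbers $\gamma^D_{n,k,p}$ such that $$\mathfrak{WD}_{n,k}(x):=\sum_{\pi\in D_n}x^{\mathrm{des}_k^D(\pi)}=\sum_{p=0}^{\lfloor (n-k+1)/2\rfloor}\gamma^D_{n,k,p}\,x^p(1+x)^{n-k+1-2p},$$ and for all $2\le k\le n$ one has $\gamma^D_{n,k,p}=\gamma^B_{n,k,p}/2$, where $\gamma^B_{n,k,p}=2^{2p+k-1}|\Gamma^{(\ell)}_{n,k,p}|$.
   Context: $B_n$ is the set of signed permutations of $[n]$: bijections $\pi$ of $\{\pm1,\dots,\pm n\}$ with $\pi(-i)=-\pi(i)$, written $\pi=(\pi(1),\dots,\pi(n))$; set $\pi(0)=0$. $D_n=\{\pi\in B_n:\ |\{i\in[n]:\pi(i)<0\}|\text{ is even}\}$, and $\mathrm{des}_k^D(\pi)=|\{0\le i\le n-k:\pi(i)>\pi(i+k)\}|$. $\mathfrak{S}_n$ is the symmetric group on $[n]$; for $\sigma\in\mathfrak{S}_n$ with convention $\sigma(0)=0$, $\mathrm{lpeak}_k(\sigma)=|\{k\le i\le n-k:\sigma(i-k)<\sigma(i)>\sigma(i+k)\}|$, and $\Gamma^{(\ell)}_{n,k,p}=\{\sigma\in\mathfrak{S}_n:\mathrm{lpeak}_k(\sigma)=p\}$. *)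

theory Defs
  imports Complex_Main
    "HOL-Computational_Algebra.Polynomial"
    "HOL-Combinatorics.Permutations"
begin

(* A permutation in the library sense fixes every point outside its carrier set,
   so the conventions \<pi> 0 = 0 and \<sigma> 0 = 0 hold automatically below. *)

definition signed_perms :: "nat \<Rightarrow> (int \<Rightarrow> int) set" where
  "signed_perms n =
     {\<pi>. \<pi> permutes ({- int n..int n} - {0}) \<and>
          (\<forall>i \<in> {- int n..int n} - {0}. \<pi> (- i) = - \<pi> i)}"

definition even_signed_perms :: "nat \<Rightarrow> (int \<Rightarrow> int) set" where
  "even_signed_perms n = {\<pi> \<in> signed_perms n. even (card {i \<in> {1..int n}. \<pi> i < 0})}"

(* The natural-number subtraction n - k is only meaningful for k \<le> n,
   here and in the following definitions. *)

definition desD :: "nat \<Rightarrow> nat \<Rightarrow> (int \<Rightarrow> int) \<Rightarrow> nat" where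
  "desD n k \<pi> = card {i \<in> {0..n - k}. \<pi> (int i) > \<pi> (int (i + k))}"

definition WD :: "nat \<Rightarrow> nat \<Rightarrow> real poly" where
  "WD n k = (\<Sum>\<pi> \<in> even_signed_perms n. monom 1 (desD n k \<pi>))"

definition lpeak :: "nat \<Rightarrow> nat \<Rightarrow> (nat \<Rightarrow> nat) \<Rightarrow> nat" where
  "lpeak n k \<sigma> = card {i \<in> {k..n - k}. \<sigma> (i - k) < \<sigma> i \<and> \<sigma> i > \<sigma> (i + k)}"

definition Gamma_l :: "nat \<Rightarrow> nat \<Rightarrow> nat \<Rightarrow> (nat \<Rightarrow> nat) set" where
  "Gamma_l n k p = {\<sigma>. \<sigma> permutes {1..n} \<and> lpeak n k \<sigma> = p}"

definition gammaB :: "nat \<Rightarrow> nat \<Rightarrow> nat \<Rightarrow> real" where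
  "gammaB n k p = 2 ^ (2 * p + k - 1) * real (card (Gamma_l n k p))"

end

theory Submission
  imports Defs
begin

text \<open>
  Write a signed permutation as a pair of a permutation \<open>\<sigma>\<close> of the absolute values and the set \<open>S\<close> of
  positions carrying a negative sign. The comparison of two entries is decided by the sign of the
  one with the larger absolute value, so for fixed \<open>\<sigma>\<close> the number of descents is a sum of
  contributions of single positions, and both the sum and the alternating sum over \<open>S\<close> factorise.
  In the former a position contributes \<open>2x\<close>, \<open>1 + x\<close> or \<open>2\<close>, according to whether two, one or none
  of its neighbours at distance \<open>k\<close> carry a smaller value. In the latter it contributes an integer
  multiple of \<open>1 - x\<close>, which vanishes unless exactly one neighbour is smaller. Half the sum of the
  two is the part belonging to even \<open>S\<close>. For \<open>k \<ge> 2\<close> some position always has no smaller neighbour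
  and the alternating sum is zero; for \<open>k = 1\<close> and \<open>n\<close> even it is a multiple of
  \<open>(1 - x)^n = ((1 + x)^2 - 4x)^(n/2)\<close>.
\<close>

subsection \<open>Signed permutations as pairs\<close>

text \<open>\<open>S\<close> holds positions, not values. The factor \<open>sgn i\<close> makes the
  map odd and zero at 0. If \<open>\<sigma>\<close> permutes \<open>{1..n}\<close> and
  \<open>S\<close> lies in \<open>{1..n}\<close>, the map fixes every integer of absolute value
  above \<open>n\<close>, as \<open>permutes\<close> demands.\<close>

definition attach_signs :: "(nat \<Rightarrow> nat) \<Rightarrow> nat set \<Rightarrow> int \<Rightarrow> int" where
  "attach_signs \<sigma> S i = sgn i * (if nat \<bar>i\<bar> \<in> S then - 1 else 1) * int (\<sigma> (nat \<bar>i\<bar>))"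

lemma attach_signs_uminus: "attach_signs \<sigma> S (- i) = - attach_signs \<sigma> S i"
  by (simp add: attach_signs_def)

lemma attach_signs_int:
  "j > 0 \<Longrightarrow> attach_signs \<sigma> S (int j) = (if j \<in> S then - int (\<sigma> j) else int (\<sigma> j))"
  by (simp add: attach_signs_def)

lemma permutes_pos:
  assumes "\<sigma> permutes {1..n::nat}"
  shows "\<sigma> j > 0 \<longleftrightarrow> j > 0"
proof (cases "j \<in> {1..n}")
  case True
  with permutes_in_image[OF assms, of j] show ?thesis by simp
next
  case False
  with permutes_not_in[OF assms, of j] show ?thesis by simp
qed

lemma nat_abs_attach_signs:
  assumes "\<sigma> permutes {1..n}"
  shows "nat \<bar>attach_signs \<sigma> S i\<bar> = \<sigma> (nat \<bar>i\<bar>)"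
  using permutes_not_in[OF assms, of 0]
  by (cases "i = 0") (auto simp: attach_signs_def abs_mult)

lemma attach_signs_pos_less_0_iff:
  assumes "\<sigma> permutes {1..n}" "i > 0"
  shows "attach_signs \<sigma> S i < 0 \<longleftrightarrow> nat i \<in> S"
proof -
  have "\<sigma> (nat i) > 0"
    using assms permutes_pos by simp
  with assms(2) show ?thesis
    by (auto simp: attach_signs_def)
qed

lemma attach_signs_in_signed_perms:
  assumes \<sigma>: "\<sigma> permutes {1..n}" and S: "S \<subseteq> {1..n}"
  shows "attach_signs \<sigma> S \<in> signed_perms n"
proof -
  let ?A = "{- int n..int n} - {0}"
  have mem: "i \<in> ?A \<longleftrightarrow> nat \<bar>i\<bar> \<in> {1..n}" for i
    by auto
  have "attach_signs \<sigma> S permutes ?A"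
  proof (rule inj_imp_permutes)
    show "inj_on (attach_signs \<sigma> S) ?A"
    proof (rule inj_onI)
      fix i j assume ij: "i \<in> ?A" "j \<in> ?A" and eq: "attach_signs \<sigma> S i = attach_signs \<sigma> S j"
      then have "\<sigma> (nat \<bar>i\<bar>) = \<sigma> (nat \<bar>j\<bar>)"
        by (metis nat_abs_attach_signs[OF \<sigma>])
      then have "nat \<bar>i\<bar> = nat \<bar>j\<bar>"
        by (simp only: inj_eq[OF permutes_inj[OF \<sigma>]])
      then have "i = j \<or> i = - j"
        by linarith
      \<comment> \<open>Excludes \<open>i = - j\<close>: by oddness the value at \<open>j\<close>
        would equal its own negative.\<close>
      moreover have "attach_signs \<sigma> S j \<noteq> 0"
        using nat_abs_attach_signs[OF \<sigma>, of S j] permutes_pos[OF \<sigma>, of "nat \<bar>j\<bar>"] ij(2) by auto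
      ultimately show "i = j"
        using eq attach_signs_uminus[of \<sigma> S j] by auto
    qed
  next
    fix i assume "i \<in> ?A"
    then show "attach_signs \<sigma> S i \<in> ?A"
      using permutes_in_image[OF \<sigma>] by (simp only: mem nat_abs_attach_signs[OF \<sigma>])
  next
    fix i assume "i \<notin> ?A"
    then have "nat \<bar>i\<bar> \<notin> {1..n}"
      using mem by blast
    moreover from this have "nat \<bar>i\<bar> \<notin> S"
      using S by blast
    ultimately show "attach_signs \<sigma> S i = i"
      using permutes_not_in[OF \<sigma>] by (simp add: attach_signs_def mult_sgn_abs)
  qed simp
  then show ?thesis
    by (simp add: signed_perms_def attach_signs_uminus)
qed

lemma signed_perms_obtain:
  assumes "\<pi> \<in> signed_perms n"
  obtains \<sigma> S where "\<sigma> permutes {1..n}" "S \<subseteq> {1..n}" "\<pi> = attach_signs \<sigma> S"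
proof
  let ?A = "{- int n..int n} - {0}"
  define \<sigma> where "\<sigma> = (\<lambda>j. nat \<bar>\<pi> (int j)\<bar>)"
  define S where "S = {j \<in> {1..n}. \<pi> (int j) < 0}"
  have \<pi>: "\<pi> permutes ?A" and "\<And>i. i \<in> ?A \<Longrightarrow> \<pi> (- i) = - \<pi> i"
    using assms by (auto simp: signed_perms_def)
  \<comment> \<open>Oddness is given only on the carrier; outside it both \<open>i\<close> and
    \<open>- i\<close> are fixed points.\<close>
  then have odd: "\<pi> (- i) = - \<pi> i" for i
    using permutes_not_in[OF \<pi>, of i] permutes_not_in[OF \<pi>, of "- i"] by (cases "i \<in> ?A") auto
  have 0: "\<pi> 0 = 0"
    using permutes_not_in[OF \<pi>] by simp
  show "\<sigma> permutes {1..n}"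
  proof (rule inj_imp_permutes)
    show "inj_on \<sigma> {1..n}"
    proof (rule inj_onI)
      fix i j assume ij: "i \<in> {1..n}" "j \<in> {1..n}" and "\<sigma> i = \<sigma> j"
      \<comment> \<open>Oddness turns equal absolute values into equal values of
        \<open>\<pi>\<close>, so its injectivity applies; positivity of \<open>i\<close> and
        \<open>j\<close> then rules out opposite arguments.\<close>
      then have "\<pi> (int i) = \<pi> (int j) \<or> \<pi> (int i) = \<pi> (- int j)"
        unfolding \<sigma>_def odd by linarith
      then have "int i = int j \<or> int i = - int j"
        by (simp only: inj_eq[OF permutes_inj[OF \<pi>]])
      then show "i = j"
        using ij by auto
    qed
  next
    fix i assume "i \<in> {1..n}"
    then have "\<pi> (int i) \<in> ?A"
      using permutes_in_image[OF \<pi>, of "int i"] by auto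
    then show "\<sigma> i \<in> {1..n}"
      by (auto simp: \<sigma>_def)
  next
    fix i assume "i \<notin> {1..n}"
    then show "\<sigma> i = i"
      using permutes_not_in[OF \<pi>, of "int i"] by (auto simp: \<sigma>_def)
  qed simp
  show "S \<subseteq> {1..n}"
    by (auto simp: S_def)
  have *: "\<pi> i = attach_signs \<sigma> S i" if "i > 0" for i
    using that permutes_not_in[OF \<pi>, of i] by (auto simp: attach_signs_def \<sigma>_def S_def)
  show "\<pi> = attach_signs \<sigma> S"
  proof
    fix i :: int
    consider "i > 0" | "i = 0" | "- i > 0"
      by linarith
    then show "\<pi> i = attach_signs \<sigma> S i"
    proof cases
      case 3
      from *[OF this] show ?thesis
        by (simp add: odd attach_signs_uminus)
    qed (auto simp: * 0 attach_signs_def)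
  qed
qed

text \<open>Absolute values recover \<open>\<sigma>\<close>, and signs at positive arguments recover
  \<open>S\<close>.\<close>

lemma inj_on_attach_signs:
  "inj_on (\<lambda>(\<sigma>, S). attach_signs \<sigma> S) ({\<sigma>. \<sigma> permutes {1..n}} \<times> Pow {1..n})"
proof (rule inj_onI, clarsimp)
  fix \<sigma> S \<tau> T
  assume \<sigma>: "\<sigma> permutes {Suc 0..n}" and S: "S \<subseteq> {Suc 0..n}"
    and \<tau>: "\<tau> permutes {Suc 0..n}" and T: "T \<subseteq> {Suc 0..n}"
    and eq: "attach_signs \<sigma> S = attach_signs \<tau> T"
  have "\<sigma> j = \<tau> j" for j
    using nat_abs_attach_signs[of \<sigma> n S "int j"] nat_abs_attach_signs[of \<tau> n T "int j"] \<sigma> \<tau> eq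
    by simp
  moreover have "j \<in> S \<longleftrightarrow> j \<in> T" for j
  proof (cases "j > 0")
    case True
    then show ?thesis
      using attach_signs_pos_less_0_iff[of \<sigma> n "int j" S]
        attach_signs_pos_less_0_iff[of \<tau> n "int j" T] \<sigma> \<tau> eq by simp
  qed (use S T in auto)
  ultimately show "\<sigma> = \<tau> \<and> S = T"
    by auto
qed

lemma card_neg_attach_signs:
  assumes "\<sigma> permutes {1..n}" "S \<subseteq> {1..n}"
  shows "card {i \<in> {1..int n}. attach_signs \<sigma> S i < 0} = card S"
proof -
  have "{i \<in> {1..int n}. attach_signs \<sigma> S i < 0} = int ` S"
  proof (intro equalityI subsetI)
    fix i assume "i \<in> {i \<in> {1..int n}. attach_signs \<sigma> S i < 0}"
    then have "i > 0" "nat i \<in> S"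
      using attach_signs_pos_less_0_iff[OF assms(1), of i S] by auto
    then show "i \<in> int ` S"
      by (intro image_eqI[of _ _ "nat i"]) auto
  next
    fix i assume "i \<in> int ` S"
    then show "i \<in> {i \<in> {1..int n}. attach_signs \<sigma> S i < 0}"
      using assms(2) attach_signs_pos_less_0_iff[OF assms(1), of i S] by auto
  qed
  then show ?thesis
    by (simp add: card_image)
qed

text \<open>The parity condition concerns \<open>S\<close> alone, so the set becomes the image of a
  product and sums over it split into a sum over \<open>\<sigma>\<close> and one over
  \<open>S\<close>.\<close>

lemma even_signed_perms_eq:
  "even_signed_perms n =
     (\<lambda>(\<sigma>, S). attach_signs \<sigma> S) ` ({\<sigma>. \<sigma> permutes {1..n}} \<times> {S \<in> Pow {1..n}. even (card S)})"
proof -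
  have "\<pi> \<in> even_signed_perms n \<longleftrightarrow>
      (\<exists>\<sigma> S. \<sigma> permutes {1..n} \<and> S \<subseteq> {1..n} \<and> even (card S) \<and> \<pi> = attach_signs \<sigma> S)" for \<pi>
  proof
    assume \<pi>: "\<pi> \<in> even_signed_perms n"
    then have "\<pi> \<in> signed_perms n"
      by (simp add: even_signed_perms_def)
    then obtain \<sigma> S where *: "\<sigma> permutes {1..n}" "S \<subseteq> {1..n}" "\<pi> = attach_signs \<sigma> S"
      by (rule signed_perms_obtain)
    moreover have "even (card S)"
      using \<pi> unfolding even_signed_perms_def *(3) mem_Collect_eq
        card_neg_attach_signs[OF *(1,2)] by (rule conjunct2)
    ultimately show "\<exists>\<sigma> S. \<sigma> permutes {1..n} \<and> S \<subseteq> {1..n} \<and> even (card S) \<and> \<pi> = attach_signs \<sigma> S"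
      by blast
  next
    assume "\<exists>\<sigma> S. \<sigma> permutes {1..n} \<and> S \<subseteq> {1..n} \<and> even (card S) \<and> \<pi> = attach_signs \<sigma> S"
    then obtain \<sigma> S where
      *: "\<sigma> permutes {1..n}" "S \<subseteq> {1..n}" and "even (card S)" "\<pi> = attach_signs \<sigma> S"
      by blast
    then show "\<pi> \<in> even_signed_perms n"
      unfolding even_signed_perms_def mem_Collect_eq
      by (simp only: card_neg_attach_signs[OF *] attach_signs_in_signed_perms[OF *])
  qed
  then show ?thesis
    by (simp only: set_eq_iff image_iff Bex_def split_paired_Ex prod.case mem_Sigma_iff
        mem_Collect_eq Pow_iff conj_assoc simp_thms)
qed

subsection \<open>Descents as a sum over positions\<close>

definition left_smaller :: "nat \<Rightarrow> (nat \<Rightarrow> nat) \<Rightarrow> nat \<Rightarrow> bool" where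
  "left_smaller k \<sigma> j \<longleftrightarrow> k \<le> j \<and> \<sigma> (j - k) < \<sigma> j"

definition right_smaller :: "nat \<Rightarrow> nat \<Rightarrow> (nat \<Rightarrow> nat) \<Rightarrow> nat \<Rightarrow> bool" where
  "right_smaller n k \<sigma> j \<longleftrightarrow> j + k \<le> n \<and> \<sigma> (j + k) < \<sigma> j"

text \<open>Double counting: each pair \<open>i\<close>, \<open>i + k\<close> is charged to the end
  with the larger value, with weight \<open>f\<close> if that is the right end and \<open>g\<close>
  if it is the left one.\<close>

lemma sum_left_right_smaller:
  fixes f g :: "nat \<Rightarrow> nat"
  assumes \<sigma>: "\<sigma> permutes {1..n}" and k: "1 \<le> k" "k \<le> n"
  shows "(\<Sum>j\<in>{1..n}. of_bool (left_smaller k \<sigma> j) * f j + of_bool (right_smaller n k \<sigma> j) * g j) =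
    (\<Sum>i\<in>{0..n - k}. if \<sigma> i < \<sigma> (i + k) then f (i + k) else g i)"
proof -
  have 0: "\<sigma> 0 = 0"
    using permutes_not_in[OF \<sigma>] by simp
  have "(\<Sum>j\<in>{1..n}. of_bool (left_smaller k \<sigma> j) * f j) =
      (\<Sum>j\<in>{k..n}. of_bool (left_smaller k \<sigma> j) * f j)"
    by (rule sum.mono_neutral_right) (use k in \<open>auto simp: left_smaller_def\<close>)
  also have "\<dots> = (\<Sum>i\<in>{0..n - k}. of_bool (\<sigma> i < \<sigma> (i + k)) * f (i + k))"
    by (rule sum.reindex_bij_witness[of _ "\<lambda>i. i + k" "\<lambda>j. j - k"])
      (use k in \<open>auto simp: left_smaller_def\<close>)
  finally have L: "(\<Sum>j\<in>{1..n}. of_bool (left_smaller k \<sigma> j) * f j) =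
      (\<Sum>i\<in>{0..n - k}. of_bool (\<sigma> i < \<sigma> (i + k)) * f (i + k))" .
  \<comment> \<open>Position 0 can be added freely: its value 0 exceeds no other.\<close>
  have "(\<Sum>j\<in>{1..n}. of_bool (right_smaller n k \<sigma> j) * g j) =
      (\<Sum>j\<in>{0..n}. of_bool (right_smaller n k \<sigma> j) * g j)"
    by (rule sum.mono_neutral_left) (auto simp: right_smaller_def 0 Suc_le_eq)
  also have "\<dots> = (\<Sum>j\<in>{0..n - k}. of_bool (right_smaller n k \<sigma> j) * g j)"
    by (rule sum.mono_neutral_right) (use k in \<open>auto simp: right_smaller_def\<close>)
  also have "\<dots> = (\<Sum>j\<in>{0..n - k}. of_bool (\<sigma> (j + k) < \<sigma> j) * g j)"
    by (rule sum.cong) (use k in \<open>auto simp: right_smaller_def\<close>)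
  finally have R: "(\<Sum>j\<in>{1..n}. of_bool (right_smaller n k \<sigma> j) * g j) =
      (\<Sum>j\<in>{0..n - k}. of_bool (\<sigma> (j + k) < \<sigma> j) * g j)" .
  have neq: "\<sigma> i \<noteq> \<sigma> (i + k)" for i
    using inj_eq[OF permutes_inj[OF \<sigma>], of i "i + k"] k by simp
  have "of_bool (\<sigma> i < \<sigma> (i + k)) * f (i + k) + of_bool (\<sigma> (i + k) < \<sigma> i) * g i =
      (if \<sigma> i < \<sigma> (i + k) then f (i + k) else g i)" for i
    using neq[of i] by (cases "\<sigma> i < \<sigma> (i + k)") auto
  then show ?thesis
    unfolding sum.distrib L R unfolding sum.distrib[symmetric] by (intro sum.cong refl)
qed

text \<open>A pair whose larger absolute value is on the right is a descent iff that entry is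
  negative; with the larger one on the left, iff that entry is not. Charging pairs to their larger
  end gives the two sums.\<close>

lemma desD_attach_signs:
  assumes \<sigma>: "\<sigma> permutes {1..n}" and S: "S \<subseteq> {1..n}" and k: "1 \<le> k" "k \<le> n"
  shows "desD n k (attach_signs \<sigma> S) =
    (\<Sum>j\<in>S. of_bool (left_smaller k \<sigma> j)) + (\<Sum>j\<in>{1..n} - S. of_bool (right_smaller n k \<sigma> j))"
proof -
  have 0: "\<sigma> 0 = 0" "0 \<notin> S"
    using permutes_not_in[OF \<sigma>] S by auto
  have descent_iff: "attach_signs \<sigma> S (int i) > attach_signs \<sigma> S (int (i + k)) \<longleftrightarrow>
      (if \<sigma> i < \<sigma> (i + k) then i + k \<in> S else i \<notin> S)" for i
  proof -
    have attach: "attach_signs \<sigma> S (int j) = (if j \<in> S then - int (\<sigma> j) else int (\<sigma> j))" for j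
      using 0 attach_signs_int[of j \<sigma> S] by (cases "j > 0") (auto simp: attach_signs_def)
    have "\<sigma> i \<noteq> \<sigma> (i + k)"
      using inj_eq[OF permutes_inj[OF \<sigma>], of i "i + k"] k by simp
    moreover have "\<sigma> (i + k) > 0"
      using permutes_pos[OF \<sigma>, of "i + k"] k by simp
    ultimately show ?thesis
      unfolding attach[of i] attach[of "i + k"] by auto
  qed
  have "desD n k (attach_signs \<sigma> S) =
      (\<Sum>i\<in>{0..n - k}. of_bool (if \<sigma> i < \<sigma> (i + k) then i + k \<in> S else i \<notin> S))"
    unfolding desD_def descent_iff by (simp add: Int_def)
  also have "\<dots> = (\<Sum>i\<in>{0..n - k}. if \<sigma> i < \<sigma> (i + k) then of_bool (i + k \<in> S) else of_bool (i \<notin> S))"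
    by (rule sum.cong) auto
  also have "\<dots> = (\<Sum>j\<in>{1..n}. of_bool (left_smaller k \<sigma> j) * of_bool (j \<in> S) +
      of_bool (right_smaller n k \<sigma> j) * of_bool (j \<notin> S))"
    using sum_left_right_smaller[OF \<sigma> k, of "\<lambda>j. of_bool (j \<in> S)" "\<lambda>j. of_bool (j \<notin> S)"] by simp
  also have "\<dots> = (\<Sum>j\<in>{1..n} \<inter> S. of_bool (left_smaller k \<sigma> j)) +
      (\<Sum>j\<in>{1..n} - S. of_bool (right_smaller n k \<sigma> j))"
    unfolding sum.distrib
    by (subst (1 2) sum_mult_of_bool_eq) (auto simp: set_diff_eq Int_def simp del: sum_of_bool_eq)
  also have "{1..n} \<inter> S = S"
    using S by auto
  finally show ?thesis .
qed

text \<open>This is the shape of one term in the expansion of a product of binomials over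
  \<open>{1..n}\<close>, as \<open>prod_add\<close> and \<open>prod_diff_conv_sum\<close>
  require.\<close>

lemma power_desD_attach_signs:
  fixes x :: "'a :: comm_ring_1"
  assumes "\<sigma> permutes {1..n}" "S \<subseteq> {1..n}" "1 \<le> k" "k \<le> n"
  shows "x ^ desD n k (attach_signs \<sigma> S) =
    (\<Prod>j\<in>S. x ^ of_bool (left_smaller k \<sigma> j)) * (\<Prod>j\<in>{1..n} - S. x ^ of_bool (right_smaller n k \<sigma> j))"
  by (simp only: desD_attach_signs[OF assms] power_add power_sum)

subsection \<open>Summation over the signs\<close>

lemma lpeak_eq:
  assumes "1 \<le> k"
  shows "lpeak n k \<sigma> = (\<Sum>j\<in>{1..n}. of_bool (left_smaller k \<sigma> j \<and> right_smaller n k \<sigma> j))"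
proof -
  have "{i \<in> {k..n - k}. \<sigma> (i - k) < \<sigma> i \<and> \<sigma> i > \<sigma> (i + k)} =
      {1..n} \<inter> {j. left_smaller k \<sigma> j \<and> right_smaller n k \<sigma> j}"
    using assms by (auto simp: left_smaller_def right_smaller_def)
  then show ?thesis
    by (simp add: lpeak_def)
qed

lemma sum_of_bool_left_right_smaller:
  assumes "\<sigma> permutes {1..n}" "1 \<le> k" "k \<le> n"
  shows "(\<Sum>j\<in>{1..n}. of_bool (left_smaller k \<sigma> j) + of_bool (right_smaller n k \<sigma> j)) = n - k + 1"
  using sum_left_right_smaller[OF assms, of "\<lambda>_. 1" "\<lambda>_. 1"] by (simp del: sum_of_bool_eq)

text \<open>A position with two smaller neighbours is a peak and is counted twice among the
  \<open>n - k + 1\<close> pairs. This yields the exponent of \<open>1 + x\<close> and the bound on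
  \<open>lpeak\<close>.\<close>

lemma sum_one_smaller:
  assumes "\<sigma> permutes {1..n}" "1 \<le> k" "k \<le> n"
  shows "2 * lpeak n k \<sigma> +
    (\<Sum>j\<in>{1..n}. of_bool (left_smaller k \<sigma> j \<noteq> right_smaller n k \<sigma> j)) = n - k + 1"
proof -
  have "2 * lpeak n k \<sigma> + (\<Sum>j\<in>{1..n}. of_bool (left_smaller k \<sigma> j \<noteq> right_smaller n k \<sigma> j)) =
      (\<Sum>j\<in>{1..n}. of_bool (left_smaller k \<sigma> j) + of_bool (right_smaller n k \<sigma> j))"
    unfolding lpeak_eq[OF assms(2)] sum_distrib_left sum.distrib[symmetric]
    by (rule sum.cong) auto
  then show ?thesis
    using sum_of_bool_left_right_smaller[OF assms] by simp
qed

text \<open>If \<open>a\<close>, \<open>b\<close>, \<open>c\<close> positions have no, one, two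
  smaller neighbours, then \<open>a + b + c = n\<close> and \<open>b + 2 * c = n - k + 1\<close>, so
  \<open>a = c + k - 1\<close>.\<close>

lemma sum_none_smaller:
  assumes "\<sigma> permutes {1..n}" "1 \<le> k" "k \<le> n"
  shows "(\<Sum>j\<in>{1..n}. of_bool (\<not> left_smaller k \<sigma> j \<and> \<not> right_smaller n k \<sigma> j)) =
    lpeak n k \<sigma> + k - 1"
proof -
  have "(\<Sum>j\<in>{1..n}. of_bool (\<not> left_smaller k \<sigma> j \<and> \<not> right_smaller n k \<sigma> j)) +
      (\<Sum>j\<in>{1..n}. of_bool (left_smaller k \<sigma> j) + of_bool (right_smaller n k \<sigma> j)) =
      (\<Sum>j\<in>{1..n}. 1 + of_bool (left_smaller k \<sigma> j \<and> right_smaller n k \<sigma> j))"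
    unfolding sum.distrib[symmetric] by (rule sum.cong) auto
  also have "\<dots> = n + lpeak n k \<sigma>"
    unfolding lpeak_eq[OF assms(2)] sum.distrib by simp
  finally show ?thesis
    using sum_of_bool_left_right_smaller[OF assms] assms(2,3) by linarith
qed

section \<open>Plain and alternating sums over the sign sets\<close>

lemma sum_signs:
  fixes x :: "'a :: comm_ring_1"
  assumes \<sigma>: "\<sigma> permutes {1..n}" and k: "1 \<le> k" "k \<le> n"
  shows "(\<Sum>S\<in>Pow {1..n}. x ^ desD n k (attach_signs \<sigma> S)) =
    2 ^ (2 * lpeak n k \<sigma> + k - 1) * (x ^ lpeak n k \<sigma> * (1 + x) ^ (n - k + 1 - 2 * lpeak n k \<sigma>))"
proof -
  let ?l = "left_smaller k \<sigma>" and ?r = "right_smaller n k \<sigma>" and ?p = "lpeak n k \<sigma>"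
  have "(\<Sum>S\<in>Pow {1..n}. x ^ desD n k (attach_signs \<sigma> S)) =
      (\<Sum>S\<in>Pow {1..n}. (\<Prod>j\<in>S. x ^ of_bool (?l j)) * (\<Prod>j\<in>{1..n} - S. x ^ of_bool (?r j)))"
    by (intro sum.cong refl power_desD_attach_signs[OF \<sigma> _ k]) auto
  also have "\<dots> = (\<Prod>j\<in>{1..n}. x ^ of_bool (?l j) + x ^ of_bool (?r j))"
    by (rule prod_add[symmetric]) simp
  \<comment> \<open>Exactly one of the three exponents is 1. Peaks and positions without smaller
    neighbours both give a factor 2, hence the power \<open>2 * p + k - 1\<close> of 2 in
    \<open>gammaB\<close>.\<close>
  also have "\<dots> = (\<Prod>j\<in>{1..n}. (2 * x) ^ of_bool (?l j \<and> ?r j) *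
      ((1 + x) ^ of_bool (?l j \<noteq> ?r j) * 2 ^ of_bool (\<not> ?l j \<and> \<not> ?r j)))"
    by (rule prod.cong) auto
  also have "\<dots> = (2 * x) ^ (\<Sum>j\<in>{1..n}. of_bool (?l j \<and> ?r j)) *
      ((1 + x) ^ (\<Sum>j\<in>{1..n}. of_bool (?l j \<noteq> ?r j)) *
       2 ^ (\<Sum>j\<in>{1..n}. of_bool (\<not> ?l j \<and> \<not> ?r j)))"
    by (simp only: prod.distrib power_sum)
  also have "(\<Sum>j\<in>{1..n}. of_bool (?l j \<and> ?r j)) = ?p"
    using lpeak_eq[OF k(1)] by simp
  also have "(\<Sum>j\<in>{1..n}. of_bool (?l j \<noteq> ?r j)) = n - k + 1 - 2 * ?p"
    using sum_one_smaller[OF assms] by linarith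
  also have "(\<Sum>j\<in>{1..n}. of_bool (\<not> ?l j \<and> \<not> ?r j)) = ?p + k - 1"
    by (rule sum_none_smaller[OF assms])
  also have "(2 * x) ^ ?p * ((1 + x) ^ (n - k + 1 - 2 * ?p) * 2 ^ (?p + k - 1)) =
      2 ^ (?p + (?p + k - 1)) * (x ^ ?p * (1 + x) ^ (n - k + 1 - 2 * ?p))"
    by (simp only: power_mult_distrib power_add mult_ac)
  also have "?p + (?p + k - 1) = 2 * ?p + k - 1"
    using k by simp
  finally show ?thesis .
qed

text \<open>The integer cofactor of \<open>(1 - x) ^ n\<close> in the alternating sum; it lies in
  {-1, 0, 1} and is nonzero only if every position has exactly one smaller neighbour.\<close>

definition signed_weight :: "nat \<Rightarrow> nat \<Rightarrow> (nat \<Rightarrow> nat) \<Rightarrow> int" where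
  "signed_weight n k \<sigma> =
     (\<Prod>j\<in>{1..n}. of_bool (left_smaller k \<sigma> j) - of_bool (right_smaller n k \<sigma> j))"

lemma alternating_sum_signs:
  fixes x :: "'a :: comm_ring_1"
  assumes \<sigma>: "\<sigma> permutes {1..n}" and k: "1 \<le> k" "k \<le> n"
  shows "(\<Sum>S\<in>Pow {1..n}. (- 1) ^ card S * x ^ desD n k (attach_signs \<sigma> S)) =
    of_int (signed_weight n k \<sigma>) * (1 - x) ^ n"
proof -
  let ?l = "left_smaller k \<sigma>" and ?r = "right_smaller n k \<sigma>"
  have "(\<Sum>S\<in>Pow {1..n}. (- 1) ^ card S * x ^ desD n k (attach_signs \<sigma> S)) =
      (\<Sum>S\<in>Pow {1..n}. (- 1) ^ card S * (\<Prod>j\<in>S. x ^ of_bool (?l j)) *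
        (\<Prod>j\<in>{1..n} - S. x ^ of_bool (?r j)))"
    by (intro sum.cong refl) (simp only: power_desD_attach_signs[OF \<sigma> _ k] Pow_iff mult.assoc)
  also have "\<dots> = (\<Prod>j\<in>{1..n}. x ^ of_bool (?r j) - x ^ of_bool (?l j))"
    by (rule prod_diff_conv_sum[symmetric]) simp
  \<comment> \<open>With equal exponents the difference vanishes; otherwise it is
    \<open>1 - x\<close> (left only) or \<open>x - 1\<close> (right only).\<close>
  also have "\<dots> = (\<Prod>j\<in>{1..n}. of_int (of_bool (?l j) - of_bool (?r j)) * (1 - x))"
    by (rule prod.cong) auto
  also have "\<dots> = of_int (signed_weight n k \<sigma>) * (1 - x) ^ n"
    by (simp add: prod.distrib signed_weight_def)
  finally show ?thesis .
qed

text \<open>By \<open>sum_none_smaller\<close> at least \<open>k - 1 > 0\<close> positions have no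
  smaller neighbour, and each contributes a zero factor.\<close>

lemma signed_weight_eq_0:
  assumes "\<sigma> permutes {1..n}" "2 \<le> k" "k \<le> n"
  shows "signed_weight n k \<sigma> = 0"
proof -
  have "(\<Sum>j\<in>{1..n}. of_bool (\<not> left_smaller k \<sigma> j \<and> \<not> right_smaller n k \<sigma> j)) \<noteq> (0 :: nat)"
    using sum_none_smaller[of \<sigma> n k] assms by simp
  then obtain j where "j \<in> {1..n}" "\<not> left_smaller k \<sigma> j" "\<not> right_smaller n k \<sigma> j"
    by (auto simp del: sum_of_bool_eq elim: sum.not_neutral_contains_not_neutral)
  then show ?thesis
    unfolding signed_weight_def by (intro prod_zero bexI[of _ j]) auto
qed

subsection \<open>The gamma expansions\<close>

lemma monom_1_eq_power: "monom 1 d = [:0, 1 :: 'a :: comm_semiring_1:] ^ d"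
  by (simp add: monom_altdef)

lemma smult_sum_right: "smult c (\<Sum>i\<in>A. f i) = (\<Sum>i\<in>A. smult c (f i))"
  by (induction A rule: infinite_finite_induct) (auto simp: smult_add_right)

text \<open>Doubling replaces the restriction to even \<open>S\<close> by the weight
  \<open>1 + (- 1) ^ card S\<close>. The two resulting sums are evaluated at the polynomial
  variable.\<close>

lemma WD_eq:
  assumes k: "1 \<le> k" "k \<le> n"
  shows "2 * WD n k =
    (\<Sum>\<sigma> | \<sigma> permutes {1..n}. 2 ^ (2 * lpeak n k \<sigma> + k - 1) *
      ([:0, 1:] ^ lpeak n k \<sigma> * [:1, 1:] ^ (n - k + 1 - 2 * lpeak n k \<sigma>))) +
    of_int (\<Sum>\<sigma> | \<sigma> permutes {1..n}. signed_weight n k \<sigma>) * [:1, - 1:] ^ n"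
proof -
  let ?X = "[:0, 1 :: real:]"
  let ?P = "{\<sigma>. \<sigma> permutes {1..n}}"
  let ?d = "\<lambda>\<sigma> S. desD n k (attach_signs \<sigma> S)"
  have "inj_on (\<lambda>(\<sigma>, S). attach_signs \<sigma> S) (?P \<times> {S \<in> Pow {1..n}. even (card S)})"
    by (rule inj_on_subset[OF inj_on_attach_signs]) blast
  then have "WD n k = (\<Sum>(\<sigma>, S) \<in> ?P \<times> {S \<in> Pow {1..n}. even (card S)}. ?X ^ ?d \<sigma> S)"
    unfolding WD_def even_signed_perms_eq monom_1_eq_power
    by (simp only: sum.reindex o_def case_prod_unfold)
  also have "\<dots> = (\<Sum>\<sigma>\<in>?P. \<Sum>S | S \<in> Pow {1..n} \<and> even (card S). ?X ^ ?d \<sigma> S)"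
    by (simp add: sum.cartesian_product)
  finally have "2 * WD n k =
      (\<Sum>\<sigma>\<in>?P. 2 * (\<Sum>S | S \<in> Pow {1..n} \<and> even (card S). ?X ^ ?d \<sigma> S))"
    by (simp only: sum_distrib_left)
  also have "\<dots> = (\<Sum>\<sigma>\<in>?P. (\<Sum>S\<in>Pow {1..n}. ?X ^ ?d \<sigma> S) +
      (\<Sum>S\<in>Pow {1..n}. (- 1) ^ card S * ?X ^ ?d \<sigma> S))"
  proof (rule sum.cong[OF refl])
    fix \<sigma>
    have "2 * (\<Sum>S | S \<in> Pow {1..n} \<and> even (card S). ?X ^ ?d \<sigma> S) =
        (\<Sum>S\<in>Pow {1..n}. if even (card S) then 2 * ?X ^ ?d \<sigma> S else 0)"
      unfolding sum_distrib_left by (rule sum.inter_filter) simp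
    also have "\<dots> = (\<Sum>S\<in>Pow {1..n}. ?X ^ ?d \<sigma> S + (- 1) ^ card S * ?X ^ ?d \<sigma> S)"
      by (rule sum.cong) auto
    finally show "2 * (\<Sum>S | S \<in> Pow {1..n} \<and> even (card S). ?X ^ ?d \<sigma> S) =
        (\<Sum>S\<in>Pow {1..n}. ?X ^ ?d \<sigma> S) + (\<Sum>S\<in>Pow {1..n}. (- 1) ^ card S * ?X ^ ?d \<sigma> S)"
      by (simp only: sum.distrib)
  qed
  also have "\<dots> = (\<Sum>\<sigma>\<in>?P. 2 ^ (2 * lpeak n k \<sigma> + k - 1) *
      (?X ^ lpeak n k \<sigma> * (1 + ?X) ^ (n - k + 1 - 2 * lpeak n k \<sigma>)) +
      of_int (signed_weight n k \<sigma>) * (1 - ?X) ^ n)"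
    by (intro sum.cong refl arg_cong2[of _ _ _ _ "(+)"] sum_signs alternating_sum_signs k) auto
  also have "1 + ?X = [:1, 1:]"
    by (simp add: one_pCons)
  also have "1 - ?X = [:1, - 1:]"
    by (simp add: one_pCons)
  finally show ?thesis
    by (simp only: sum.distrib of_int_sum sum_distrib_right)
qed

text \<open>Summands depend on \<open>\<sigma>\<close> only through \<open>lpeak\<close>, so
  grouping by its value produces the cardinalities in \<open>gammaB\<close>.\<close>

lemma sum_over_lpeak:
  assumes k: "1 \<le> k" "k \<le> n"
  shows "(\<Sum>\<sigma> | \<sigma> permutes {1..n}. 2 ^ (2 * lpeak n k \<sigma> + k - 1) * F (lpeak n k \<sigma>)) =
    (\<Sum>p = 0..(n - k + 1) div 2. smult (gammaB n k p) (F p :: real poly))"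
proof -
  let ?P = "{\<sigma>. \<sigma> permutes {1..n}}"
  let ?G = "\<lambda>p. 2 ^ (2 * p + k - 1) * F p"
  have "lpeak n k ` ?P \<subseteq> {0..(n - k + 1) div 2}"
    using sum_one_smaller[OF _ k] by fastforce
  then have "(\<Sum>\<sigma>\<in>?P. ?G (lpeak n k \<sigma>)) =
      (\<Sum>p = 0..(n - k + 1) div 2. \<Sum>\<sigma> | \<sigma> \<in> ?P \<and> lpeak n k \<sigma> = p. ?G (lpeak n k \<sigma>))"
    by (intro sum.group[symmetric] finite_permutations) auto
  also have "\<dots> = (\<Sum>p = 0..(n - k + 1) div 2. smult (gammaB n k p) (F p))"
  proof (rule sum.cong[OF refl])
    fix p
    have "(\<Sum>\<sigma> | \<sigma> \<in> ?P \<and> lpeak n k \<sigma> = p. ?G (lpeak n k \<sigma>)) = (\<Sum>\<sigma>\<in>Gamma_l n k p. ?G p)"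
      by (rule sum.cong) (auto simp: Gamma_l_def)
    also have "\<dots> = of_nat (2 ^ (2 * p + k - 1) * card (Gamma_l n k p)) * F p"
      by (simp add: mult_ac)
    also have "\<dots> = smult (gammaB n k p) (F p)"
      unfolding of_nat_poly by (simp add: gammaB_def)
    finally show "(\<Sum>\<sigma> | \<sigma> \<in> ?P \<and> lpeak n k \<sigma> = p. ?G (lpeak n k \<sigma>)) = smult (gammaB n k p) (F p)" .
  qed
  finally show ?thesis .
qed

text \<open>Binomial expansion of \<open>((1 + x)^2 - 4 * x) ^ m\<close>. The even exponent is what
  forces \<open>n\<close> to be even when \<open>k = 1\<close>.\<close>

lemma one_minus_X_power_even:
  "[:1, - 1 :: 'a :: comm_ring_1:] ^ (2 * m) =
    (\<Sum>p = 0..m. smult (of_nat (m choose p) * (- 4) ^ p) ([:0, 1:] ^ p * [:1, 1:] ^ (2 * m - 2 * p)))"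
proof -
  have "[:1, - 1 :: 'a:] ^ (2 * m) = ([:0, - 4:] + [:1, 1:] ^ 2) ^ m"
    unfolding power_mult by (rule arg_cong[of _ _ "\<lambda>q. q ^ m"]) (simp add: power2_eq_square)
  also have "\<dots> = (\<Sum>p\<le>m. of_nat (m choose p) * [:0, - 4:] ^ p * ([:1, 1:] ^ 2) ^ (m - p))"
    by (rule binomial_ring)
  also have "\<dots> = (\<Sum>p = 0..m. smult (of_nat (m choose p) * (- 4) ^ p)
      ([:0, 1:] ^ p * [:1, 1:] ^ (2 * m - 2 * p)))"
    unfolding atMost_atLeast0
  proof (rule sum.cong[OF refl])
    fix p
    have "[:0, - 4 :: 'a:] ^ p = smult ((- 4) ^ p) ([:0, 1:] ^ p)"
      using smult_power[of "- 4" "[:0, 1 :: 'a:]" p] by simp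
    then show "of_nat (m choose p) * [:0, - 4 :: 'a:] ^ p * ([:1, 1:] ^ 2) ^ (m - p) =
        smult (of_nat (m choose p) * (- 4) ^ p) ([:0, 1:] ^ p * [:1, 1:] ^ (2 * m - 2 * p))"
      by (simp add: of_nat_poly power_mult[symmetric] diff_mult_distrib mult.commute)
  qed
  finally show ?thesis .
qed

text \<open>The second summand is the alternating part, present only for \<open>k = 1\<close>; both
  halves undo the doubling in \<open>WD_eq\<close>.\<close>

definition gamma_coeff :: "nat \<Rightarrow> nat \<Rightarrow> nat \<Rightarrow> real" where
  "gamma_coeff n k p = gammaB n k p / 2 +
     (if k = 1 then of_int (\<Sum>\<sigma> | \<sigma> permutes {1..n}. signed_weight n k \<sigma>) *
        (of_nat (n div 2 choose p) * (- 4) ^ p) / 2 else 0)"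

lemma WD_gamma_expansion:
  assumes k: "1 \<le> k" "k \<le> n" and parity: "\<not> (odd n \<and> k = 1)"
  shows "WD n k = (\<Sum>p = 0..(n - k + 1) div 2.
    smult (gamma_coeff n k p) ([:0, 1:] ^ p * [:1, 1:] ^ (n - k + 1 - 2 * p)))"
proof -
  let ?F = "\<lambda>p. [:0, 1 :: real:] ^ p * [:1, 1:] ^ (n - k + 1 - 2 * p)"
  let ?c = "\<Sum>\<sigma> | \<sigma> permutes {1..n}. signed_weight n k \<sigma>"
  \<comment> \<open>For \<open>k = 1\<close> the degree \<open>n - k + 1\<close> equals
    \<open>n = 2 * m\<close>, so the alternating part uses the same basis and range as the main
    part; for larger \<open>k\<close> its coefficient is zero.\<close>
  have alt: "of_int ?c * [:1, - 1:] ^ n = (\<Sum>p = 0..(n - k + 1) div 2.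
      smult (if k = 1 then of_int ?c * (of_nat (n div 2 choose p) * (- 4) ^ p) else 0) (?F p))"
  proof (cases "k = 1")
    case True
    with parity obtain m where m: "n = 2 * m"
      by auto
    have "of_int ?c * [:1, - 1:] ^ n = smult (of_int ?c) ([:1, - 1 :: real:] ^ (2 * m))"
      by (simp add: of_int_poly m)
    also have "\<dots> = (\<Sum>p = 0..m. smult (of_int ?c * (of_nat (m choose p) * (- 4) ^ p)) (?F p))"
      unfolding one_minus_X_power_even smult_sum_right using True m k by (simp add: mult_ac)
    finally show ?thesis
      using True m k by simp
  next
    case False
    then have "?c = 0"
      using k by (intro sum.neutral) (auto intro: signed_weight_eq_0)
    with False show ?thesis by simp
  qed
  have "2 * WD n k = (\<Sum>p = 0..(n - k + 1) div 2. smult (gammaB n k p) (?F p)) +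
      of_int ?c * [:1, - 1:] ^ n"
    unfolding WD_eq[OF k] sum_over_lpeak[OF k, of ?F] ..
  also have "\<dots> = (\<Sum>p = 0..(n - k + 1) div 2. smult 2 (smult (gamma_coeff n k p) (?F p)))"
    unfolding alt sum.distrib[symmetric] smult_add_left[symmetric] smult_smult gamma_coeff_def
    by (intro sum.cong refl arg_cong2[of _ _ _ _ smult]) (simp add: field_simps)
  also have "\<dots> = 2 * (\<Sum>p = 0..(n - k + 1) div 2. smult (gamma_coeff n k p) (?F p))"
    unfolding smult_sum_right[symmetric] by (simp add: numeral_poly)
  finally show ?thesis
    by simp
qed

theorem theorem29:
  shows "\<exists>gammaD :: nat \<Rightarrow> nat \<Rightarrow> nat \<Rightarrow> real.
    (\<forall>n k. 1 \<le> k \<and> k \<le> n \<and> \<not> (odd n \<and> k = 1) \<longrightarrow>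
       WD n k = (\<Sum>p = 0..(n - k + 1) div 2.
         smult (gammaD n k p) ([:0, 1:] ^ p * [:1, 1:] ^ (n - k + 1 - 2 * p)))) \<and>
    (\<forall>n k p. 2 \<le> k \<and> k \<le> n \<longrightarrow> gammaD n k p = gammaB n k p / 2)"
  using WD_gamma_expansion by (intro exI[of _ gamma_coeff]) (auto simp: gamma_coeff_def)

end
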